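(* Let $(T,h)$, $(M,\varphi)$ be Riemannian manifolds, $p=\dim T$, and let $X^{(i)}_{(\alpha)}(t^\gamma,x^k)$ be a d-tensor field on $J^1(T,M)$ not depending on $x^m_\mu$. Let $(H,G)$ be the canonical multi-time dependent spray of the associated space $PDEsEDML^n_p$ and put $\mathcal{G}^i=h^{\alpha\beta}G^{(i)}_{(\alpha)\beta}$. Then the canonical nonlinear connection $\Gamma=(M^{(i)}_{(\alpha)\beta},N^{(i)}_{(\alpha)j})$ of $PDEsEDML^n_p$ is determined by the temporal components $$M^{(i)}_{(\alpha)\beta}=2H^{(i)}_{(\alpha)\beta}=\stackrel{0}{M}{}^{(i)}_{(\alpha)\beta}$$ and the local spatial components $$N^{(i)}_{(\alpha)j}=\frac{\partial\mathcal{G}^i}{\partial x^j_\gamma}h_{\alpha\gamma}=\stackrel{0}{N}{}^{(i)}_{(\alpha)j}-F^{\;\;i}_{j\alpha},$$ where $\stackrel{0}{M}{}^{(i)}_{(\alpha)\beta}=-H^\gamma_{\alpha\beta}x^i_\gamma$, $\stackrel{0}{N}{}^{(i)}_{(\alpha)j}=\gamma^i_{jk}x^k_\alpha$ and $$F^{\;\;i}_{j\alpha}=\tfrac12\left[X^{(i)}_{(\alpha)\Vert j}-\varphi^{ir}X^{(s)}_{(\alpha)\Vert r}\varphi_{sj}\right].$$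
   Context: $T$, $M$ are smooth connected manifolds of dimensions $p$, $n$ with local coordinates $(t^\alpha)$, $(x^i)$; $J^1(T,M)$ has local coordinates $(t^\alpha,x^i,x^i_\alpha)$. Summation over repeated indices is understood. $H^\gamma_{\alpha\beta}$, $\gamma^i_{jk}$ are the Christoffel symbols of $h$, $\varphi$; $h^{\alpha\beta}$, $\varphi^{ij}$ are the inverse metrics. A d-tensor $X^{(i)}_{(\alpha)}$ is a family of smooth local components transforming like those of a vertical vector field $X^{(i)}_{(\alpha)}\partial/\partial x^i_\alpha$. Its covariant derivatives are $X^{(i)}_{(\alpha)//\beta}=\partial X^{(i)}_{(\alpha)}/\partial t^\beta-X^{(i)}_{(\mu)}H^\mu_{\alpha\beta}$ and $X^{(i)}_{(\alpha)\Vert j}=\partial X^{(i)}_{(\alpha)}/\partial x^j+X^{(m)}_{(\alpha)}\gamma^i_{mj}$. The space $PDEsEDML^n_p$ attached to the PDE system $\partial x^i/\partial t^\alpha=X^{(i)}_{(\alpha)}(t,x(t))$ and the metrics $h,\varphi$ is the pair $(J^1(T,M),L)$ with $L=h^{\alpha\beta}\varphi_{ij}(x^i_\alpha-X^{(i)}_{(\alpha)})(x^j_\beta-X^{(j)}_{(\beta)})$. Its canonical multi-time dependent spray $(H,G)$ is $$H^{(i)}_{(\alpha)\beta}=-\tfrac12H^\gamma_{\alpha\beta}x^i_\gamma,\qquad G^{(i)}_{(\alpha)\beta}=\tfrac12\gamma^i_{jk}x^j_\alpha x^k_\beta+h_{\alpha\beta}F^i,$$ $$F^i=-\frac{h^{\mu\nu}}{2p}\left\{\varphi^{il}X^{(s)}_{(\nu)\Vert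 l}\varphi_{sr}[X^{(r)}_{(\mu)}-x^r_\mu]+X^{(i)}_{(\nu)\Vert m}x^m_\mu+X^{(i)}_{(\nu)//\mu}\right\}.$$ The canonical nonlinear connection of $PDEsEDML^n_p$ is the one induced by this spray through $M^{(i)}_{(\alpha)\beta}=2H^{(i)}_{(\alpha)\beta}$ and $N^{(i)}_{(\alpha)j}=\frac{\partial\mathcal{G}^i}{\partial x^j_\gamma}h_{\alpha\gamma}$. *)

theory Defs
  imports "HOL-Analysis.Analysis"
begin

section \<open>Smooth maps and smooth manifolds\<close>

text \<open>Meant for open \<^term>\<open>S\<close>, where derivatives are the unrestricted ones.\<close>

primrec Ck_on :: "nat \<Rightarrow> ('a::real_normed_vector \<Rightarrow> 'b::real_normed_vector) \<Rightarrow> 'a set \<Rightarrow> bool" where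
  "Ck_on 0 f S \<longleftrightarrow> continuous_on S f"
| "Ck_on (Suc k) f S \<longleftrightarrow>
     (\<forall>x\<in>S. f differentiable (at x)) \<and> (\<forall>v. Ck_on k (\<lambda>x. frechet_derivative f (at x) v) S)"

definition smooth_on :: "('a::real_normed_vector \<Rightarrow> 'b::real_normed_vector) \<Rightarrow> 'a set \<Rightarrow> bool" where
  "smooth_on f S \<longleftrightarrow> (\<forall>k. Ck_on k f S)"

text \<open>A chart is a pair (domain, coordinate map); the coordinate map is only relevant on the domain.\<close>

type_synonym ('a, 'n) chart = "'a set \<times> ('a \<Rightarrow> real ^ 'n)"

definition coord_range :: "('a, 'n::finite) chart \<Rightarrow> (real ^ 'n) set" where
  "coord_range c = snd c ` fst c"

definition overlap :: "('a, 'n::finite) chart \<Rightarrow> ('a, 'n) chart \<Rightarrow> (real ^ 'n) set" where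
  "overlap c d = snd c ` (fst c \<inter> fst d)"

definition transition :: "('a, 'n::finite) chart \<Rightarrow> ('a, 'n) chart \<Rightarrow> real ^ 'n \<Rightarrow> real ^ 'n" where
  "transition c d = snd d \<circ> inv_into (fst c) (snd c)"

definition is_chart :: "'a topology \<Rightarrow> ('a, 'n::finite) chart \<Rightarrow> bool" where
  "is_chart X c \<longleftrightarrow> openin X (fst c) \<and> open (coord_range c) \<and>
     homeomorphic_map (subtopology X (fst c)) (top_of_set (coord_range c)) (snd c)"

text \<open>A connected smooth manifold of dimension \<^term>\<open>CARD('n)\<close>, given by an arbitrary smooth atlas
  (in particular, possibly the maximal one).\<close>

definition connected_smooth_manifold :: "'a topology \<Rightarrow> ('a, 'n::finite) chart set \<Rightarrow> bool" where
  "connected_smooth_manifold X A \<longleftrightarrow>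
     Hausdorff_space X \<and> second_countable X \<and> connected_space X \<and>
     (\<forall>c\<in>A. is_chart X c) \<and> (\<Union>c\<in>A. fst c) = topspace X \<and>
     (\<forall>c\<in>A. \<forall>d\<in>A. smooth_on (transition c d) (overlap c d))"

section \<open>Riemannian metrics\<close>

text \<open>A Riemannian metric is the family of its component matrices, one matrix-valued function
  for every chart of the atlas, obeying the transformation law of covariant 2-tensors.\<close>

definition riemannian_metric ::
    "('a, 'n::finite) chart set \<Rightarrow> (('a, 'n) chart \<Rightarrow> real ^ 'n \<Rightarrow> real ^ 'n ^ 'n) \<Rightarrow> bool" where
  "riemannian_metric A g \<longleftrightarrow>
     (\<forall>c\<in>A. smooth_on (g c) (coord_range c) \<and>
        (\<forall>u\<in>coord_range c. transpose (g c u) = g c u \<and> (\<forall>v. v \<noteq> 0 \<longrightarrow> v \<bullet> (g c u *v v) > 0))) \<and>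
     (\<forall>c\<in>A. \<forall>d\<in>A. \<forall>u\<in>overlap c d.
        let J = jacobian (transition c d) (at u)
        in g c u = transpose J ** g d (transition c d u) ** J)"

text \<open>\<^term>\<open>pd f z v\<close> is the partial derivative of \<^term>\<open>f\<close> at \<^term>\<open>z\<close> along the coordinate vector \<^term>\<open>v\<close>.\<close>

definition pd :: "('a::real_normed_vector \<Rightarrow> real) \<Rightarrow> 'a \<Rightarrow> 'a \<Rightarrow> real" where
  "pd f z v = deriv (\<lambda>s. f (z + s *\<^sub>R v)) 0"

definition inv_metric :: "(real ^ 'n \<Rightarrow> real ^ 'n ^ 'n) \<Rightarrow> real ^ 'n \<Rightarrow> 'n \<Rightarrow> 'n::finite \<Rightarrow> real" where
  "inv_metric g u i j = matrix_inv (g u) $ i $ j"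

text \<open>\<^term>\<open>christoffel g u i j k\<close> has upper index \<^term>\<open>i\<close> and lower indices \<^term>\<open>j\<close>, \<^term>\<open>k\<close>.\<close>

definition christoffel :: "(real ^ 'n \<Rightarrow> real ^ 'n ^ 'n) \<Rightarrow> real ^ 'n \<Rightarrow> 'n \<Rightarrow> 'n \<Rightarrow> 'n::finite \<Rightarrow> real" where
  "christoffel g u i j k = 1 / 2 * (\<Sum>l\<in>UNIV. inv_metric g u i l *
     (pd (\<lambda>w. g w $ l $ j) u (axis k 1) + pd (\<lambda>w. g w $ l $ k) u (axis j 1)
       - pd (\<lambda>w. g w $ j $ k) u (axis l 1)))"

section \<open>The jet bundle of order one and d-tensors\<close>

text \<open>Coordinates on the jet bundle attached to a chart \<^term>\<open>a\<close> of the source and a chart \<^term>\<open>c\<close> of the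
  target are triples \<^term>\<open>(t, x, y)\<close>, where \<^term>\<open>y $ i $ \<alpha>\<close> stands for the jet coordinate of \<^term>\<open>x $ i\<close>
  with respect to \<^term>\<open>t $ \<alpha>\<close>. They range over \<^term>\<open>jet_domain a c\<close>.\<close>

type_synonym ('p, 'n) jet = "(real ^ 'p) \<times> (real ^ 'n) \<times> (real ^ 'p ^ 'n)"

abbreviation jet_t :: "('p::finite, 'n::finite) jet \<Rightarrow> real ^ 'p" where
  "jet_t z \<equiv> fst z"

abbreviation jet_x :: "('p::finite, 'n::finite) jet \<Rightarrow> real ^ 'n" where
  "jet_x z \<equiv> fst (snd z)"

abbreviation jet_y :: "('p::finite, 'n::finite) jet \<Rightarrow> real ^ 'p ^ 'n" where
  "jet_y z \<equiv> snd (snd z)"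

abbreviation dt :: "'p \<Rightarrow> ('p::finite, 'n::finite) jet" where
  "dt \<beta> \<equiv> (axis \<beta> 1, 0, 0)"

abbreviation dx :: "'n \<Rightarrow> ('p::finite, 'n::finite) jet" where
  "dx j \<equiv> (0, axis j 1, 0)"

abbreviation dy :: "'n \<Rightarrow> 'p \<Rightarrow> ('p::finite, 'n::finite) jet" where
  "dy j \<gamma> \<equiv> (0, 0, axis j (axis \<gamma> 1))"

definition jet_domain :: "('t, 'p::finite) chart \<Rightarrow> ('m, 'n::finite) chart \<Rightarrow> ('p, 'n) jet set" where
  "jet_domain a c = coord_range a \<times> coord_range c \<times> UNIV"

text \<open>In the change of chart from \<^term>\<open>(a, c)\<close> to \<^term>\<open>(a', c')\<close>, both the jet coordinates and the
  components of a vertical vector field are multiplied on the left by the Jacobian of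
  the new \<^term>\<open>x\<close> with respect to the old one, and on the right by that of the old
  \<^term>\<open>t\<close> with respect to the new one.\<close>

definition vertical_transform ::
    "('t, 'p::finite) chart \<Rightarrow> ('m, 'n::finite) chart \<Rightarrow> ('t, 'p) chart \<Rightarrow> ('m, 'n) chart \<Rightarrow>
     real ^ 'p \<Rightarrow> real ^ 'n \<Rightarrow> real ^ 'p ^ 'n \<Rightarrow> real ^ 'p ^ 'n" where
  "vertical_transform a c a' c' t x V =
     jacobian (transition c c') (at x) ** V ** jacobian (transition a' a) (at (transition a a' t))"

definition jet_transition ::
    "('t, 'p::finite) chart \<Rightarrow> ('m, 'n::finite) chart \<Rightarrow> ('t, 'p) chart \<Rightarrow> ('m, 'n) chart \<Rightarrow>
     ('p, 'n) jet \<Rightarrow> ('p, 'n) jet" where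
  "jet_transition a c a' c' z =
     (transition a a' (jet_t z), transition c c' (jet_x z),
      vertical_transform a c a' c' (jet_t z) (jet_x z) (jet_y z))"

definition d_tensor ::
    "('t, 'p::finite) chart set \<Rightarrow> ('m, 'n::finite) chart set \<Rightarrow>
     (('t, 'p) chart \<Rightarrow> ('m, 'n) chart \<Rightarrow> ('p, 'n) jet \<Rightarrow> real ^ 'p ^ 'n) \<Rightarrow> bool" where
  "d_tensor A C X \<longleftrightarrow>
     (\<forall>a\<in>A. \<forall>c\<in>C. smooth_on (X a c) (jet_domain a c)) \<and>
     (\<forall>a\<in>A. \<forall>a'\<in>A. \<forall>c\<in>C. \<forall>c'\<in>C. \<forall>z\<in>overlap a a' \<times> overlap c c' \<times> UNIV.
        X a' c' (jet_transition a c a' c' z) =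
        vertical_transform a c a' c' (jet_t z) (jet_x z) (X a c z))"

definition independent_of_jets ::
    "('t, 'p::finite) chart set \<Rightarrow> ('m, 'n::finite) chart set \<Rightarrow>
     (('t, 'p) chart \<Rightarrow> ('m, 'n) chart \<Rightarrow> ('p, 'n) jet \<Rightarrow> real ^ 'p ^ 'n) \<Rightarrow> bool" where
  "independent_of_jets A C X \<longleftrightarrow>
     (\<forall>a\<in>A. \<forall>c\<in>C. \<forall>t\<in>coord_range a. \<forall>x\<in>coord_range c. \<forall>y y'. X a c (t, x, y) = X a c (t, x, y'))"

section \<open>The space attached to the PDE system\<close>

text \<open>From here on, \<^term>\<open>h\<close>, \<^term>\<open>\<phi>\<close> and \<^term>\<open>X\<close> are the components in one fixed pair of charts.
  The covariant derivatives of \<^term>\<open>X\<close> have the index order: upper index, lower index, derivative index.\<close>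

definition cov_t ::
    "(real ^ 'p \<Rightarrow> real ^ 'p ^ 'p) \<Rightarrow> (('p::finite, 'n::finite) jet \<Rightarrow> real ^ 'p ^ 'n) \<Rightarrow>
     ('p, 'n) jet \<Rightarrow> 'n \<Rightarrow> 'p \<Rightarrow> 'p \<Rightarrow> real" where
  "cov_t h X z i \<alpha> \<beta> = pd (\<lambda>w. X w $ i $ \<alpha>) z (dt \<beta>)
     - (\<Sum>\<mu>\<in>UNIV. X z $ i $ \<mu> * christoffel h (jet_t z) \<mu> \<alpha> \<beta>)"

definition cov_x ::
    "(real ^ 'n \<Rightarrow> real ^ 'n ^ 'n) \<Rightarrow> (('p::finite, 'n::finite) jet \<Rightarrow> real ^ 'p ^ 'n) \<Rightarrow>
     ('p, 'n) jet \<Rightarrow> 'n \<Rightarrow> 'p \<Rightarrow> 'n \<Rightarrow> real" where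
  "cov_x \<phi> X z i \<alpha> j = pd (\<lambda>w. X w $ i $ \<alpha>) z (dx j)
     + (\<Sum>m\<in>UNIV. X z $ m $ \<alpha> * christoffel \<phi> (jet_x z) i m j)"

text \<open>The Lagrangian of the space; \<^term>\<open>canonical_spray\<close> below is the explicit form of its
  canonical multi-time dependent spray.\<close>

definition edml_lagrangian ::
    "(real ^ 'p \<Rightarrow> real ^ 'p ^ 'p) \<Rightarrow> (real ^ 'n \<Rightarrow> real ^ 'n ^ 'n) \<Rightarrow>
     (('p::finite, 'n::finite) jet \<Rightarrow> real ^ 'p ^ 'n) \<Rightarrow> ('p, 'n) jet \<Rightarrow> real" where
  "edml_lagrangian h \<phi> X z =
     (\<Sum>\<alpha>\<in>UNIV. \<Sum>\<beta>\<in>UNIV. \<Sum>i\<in>UNIV. \<Sum>j\<in>UNIV.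
        inv_metric h (jet_t z) \<alpha> \<beta> * \<phi> (jet_x z) $ i $ j *
        (jet_y z $ i $ \<alpha> - X z $ i $ \<alpha>) * (jet_y z $ j $ \<beta> - X z $ j $ \<beta>))"

definition edml_F ::
    "(real ^ 'p \<Rightarrow> real ^ 'p ^ 'p) \<Rightarrow> (real ^ 'n \<Rightarrow> real ^ 'n ^ 'n) \<Rightarrow>
     (('p::finite, 'n::finite) jet \<Rightarrow> real ^ 'p ^ 'n) \<Rightarrow> ('p, 'n) jet \<Rightarrow> 'n \<Rightarrow> real" where
  "edml_F h \<phi> X z i =
     - (\<Sum>\<mu>\<in>UNIV. \<Sum>\<nu>\<in>UNIV. inv_metric h (jet_t z) \<mu> \<nu> / (2 * real CARD('p)) *
         ((\<Sum>l\<in>UNIV. \<Sum>s\<in>UNIV. \<Sum>r\<in>UNIV.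
             inv_metric \<phi> (jet_x z) i l * cov_x \<phi> X z s \<nu> l * \<phi> (jet_x z) $ s $ r *
             (X z $ r $ \<mu> - jet_y z $ r $ \<mu>))
          + (\<Sum>m\<in>UNIV. cov_x \<phi> X z i \<nu> m * jet_y z $ m $ \<mu>)
          + cov_t h X z i \<nu> \<mu>))"

text \<open>Components \<^term>\<open>H z i \<alpha> \<beta>\<close>, \<^term>\<open>G z i \<alpha> \<beta>\<close> of a spray, and components \<^term>\<open>M z i \<alpha> \<beta>\<close>,
  \<^term>\<open>N z i \<alpha> j\<close> of a nonlinear connection, have the upper index \<^term>\<open>i\<close>.\<close>

type_synonym ('p, 'n) temporal = "('p, 'n) jet \<Rightarrow> 'n \<Rightarrow> 'p \<Rightarrow> 'p \<Rightarrow> real"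
type_synonym ('p, 'n) spatial = "('p, 'n) jet \<Rightarrow> 'n \<Rightarrow> 'p \<Rightarrow> 'n \<Rightarrow> real"

definition canonical_spray ::
    "(real ^ 'p \<Rightarrow> real ^ 'p ^ 'p) \<Rightarrow> (real ^ 'n \<Rightarrow> real ^ 'n ^ 'n) \<Rightarrow>
     (('p::finite, 'n::finite) jet \<Rightarrow> real ^ 'p ^ 'n) \<Rightarrow> ('p, 'n) temporal \<times> ('p, 'n) temporal" where
  "canonical_spray h \<phi> X =
     (\<lambda>z i \<alpha> \<beta>. - (1 / 2) * (\<Sum>\<gamma>\<in>UNIV. christoffel h (jet_t z) \<gamma> \<alpha> \<beta> * jet_y z $ i $ \<gamma>),
      \<lambda>z i \<alpha> \<beta>. 1 / 2 * (\<Sum>j\<in>UNIV. \<Sum>k\<in>UNIV.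
          christoffel \<phi> (jet_x z) i j k * jet_y z $ j $ \<alpha> * jet_y z $ k $ \<beta>)
        + h (jet_t z) $ \<alpha> $ \<beta> * edml_F h \<phi> X z i)"

definition spray_trace ::
    "(real ^ 'p \<Rightarrow> real ^ 'p ^ 'p) \<Rightarrow> ('p::finite, 'n::finite) temporal \<Rightarrow> ('p, 'n) jet \<Rightarrow> 'n \<Rightarrow> real" where
  "spray_trace h G z i = (\<Sum>\<alpha>\<in>UNIV. \<Sum>\<beta>\<in>UNIV. inv_metric h (jet_t z) \<alpha> \<beta> * G z i \<alpha> \<beta>)"

definition connection_of_spray ::
    "(real ^ 'p \<Rightarrow> real ^ 'p ^ 'p) \<Rightarrow> ('p::finite, 'n::finite) temporal \<times> ('p, 'n) temporal \<Rightarrow>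
     ('p, 'n) temporal \<times> ('p, 'n) spatial" where
  "connection_of_spray h S =
     (\<lambda>z i \<alpha> \<beta>. 2 * fst S z i \<alpha> \<beta>,
      \<lambda>z i \<alpha> j. \<Sum>\<gamma>\<in>UNIV. pd (\<lambda>w. spray_trace h (snd S) w i) z (dy j \<gamma>) * h (jet_t z) $ \<alpha> $ \<gamma>)"

definition canonical_connection ::
    "(real ^ 'p \<Rightarrow> real ^ 'p ^ 'p) \<Rightarrow> (real ^ 'n \<Rightarrow> real ^ 'n ^ 'n) \<Rightarrow>
     (('p::finite, 'n::finite) jet \<Rightarrow> real ^ 'p ^ 'n) \<Rightarrow> ('p, 'n) temporal \<times> ('p, 'n) spatial" where
  "canonical_connection h \<phi> X = connection_of_spray h (canonical_spray h \<phi> X)"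

definition M0 :: "(real ^ 'p \<Rightarrow> real ^ 'p ^ 'p) \<Rightarrow> ('p::finite, 'n::finite) temporal" where
  "M0 h z i \<alpha> \<beta> = - (\<Sum>\<gamma>\<in>UNIV. christoffel h (jet_t z) \<gamma> \<alpha> \<beta> * jet_y z $ i $ \<gamma>)"

definition N0 :: "(real ^ 'n \<Rightarrow> real ^ 'n ^ 'n) \<Rightarrow> ('p::finite, 'n::finite) spatial" where
  "N0 \<phi> z i \<alpha> j = (\<Sum>k\<in>UNIV. christoffel \<phi> (jet_x z) i j k * jet_y z $ k $ \<alpha>)"

text \<open>\<^term>\<open>edml_force \<phi> X z i \<alpha> j\<close> has the upper index \<^term>\<open>i\<close> and the lower indices \<^term>\<open>j\<close>, \<^term>\<open>\<alpha>\<close>.\<close>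

definition edml_force ::
    "(real ^ 'n \<Rightarrow> real ^ 'n ^ 'n) \<Rightarrow> (('p::finite, 'n::finite) jet \<Rightarrow> real ^ 'p ^ 'n) \<Rightarrow>
     ('p, 'n) spatial" where
  "edml_force \<phi> X z i \<alpha> j = 1 / 2 * (cov_x \<phi> X z i \<alpha> j
     - (\<Sum>r\<in>UNIV. \<Sum>s\<in>UNIV. inv_metric \<phi> (jet_x z) i r * cov_x \<phi> X z s \<alpha> r * \<phi> (jet_x z) $ s $ j))"

end

theory Submission
  imports Defs
begin

text \<open>As \<open>X\<close> and its covariant derivatives do not depend on the jet coordinates \<open>y\<close>, and the trace of the
  inverse of \<open>h\<close> against \<open>h\<close> cancels the factor \<open>1 / p\<close> of \<open>F\<close>, the trace of \<open>G\<close> is a quadratic polynomial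
  in \<open>y\<close> on each fibre. Its derivative is affine, with the index raised by \<open>h\<close>; lowering that index gives
  \<open>N0\<close> from the two equal halves of the quadratic part and the force from the linear part.\<close>

text \<open>Positive definiteness leaves only the zero vector in the kernel of \<open>g c u\<close>,
  and a square matrix with trivial kernel is invertible.\<close>

lemma riemannian_metricD:
  assumes "riemannian_metric A g" "c \<in> A" "u \<in> coord_range c"
  shows "g c u $ i $ j = g c u $ j $ i" and "invertible (g c u)"
proof -
  have sym: "transpose (g c u) = g c u"
    and pos: "\<And>v. v \<noteq> 0 \<Longrightarrow> v \<bullet> (g c u *v v) > 0"
    using assms unfolding riemannian_metric_def by blast+
  show "g c u $ i $ j = g c u $ j $ i"
    using arg_cong[OF sym, of "\<lambda>m. m $ j $ i"] by (simp add: transpose_def)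
  have "v = 0" if "g c u *v v = 0" for v
    using pos[of v] that by fastforce
  then have "\<exists>B. B ** g c u = mat 1"
    using matrix_left_invertible_ker by blast
  then show "invertible (g c u)"
    by (simp add: invertible_left_inverse)
qed

lemma sum_matrix_inv:
  assumes "invertible (m :: real ^ 'n ^ 'n)"
  shows "(\<Sum>k\<in>UNIV. matrix_inv m $ i $ k * m $ k $ j) = of_bool (i = j)"
    and "(\<Sum>k\<in>UNIV. m $ i $ k * matrix_inv m $ k $ j) = of_bool (i = j)"
proof -
  \<comment> \<open>\<open>matrix_inv\<close> is a Hilbert choice; invertibility guarantees that the
    chosen matrix is a two-sided inverse.\<close>
  have "m ** matrix_inv m = mat 1 \<and> matrix_inv m ** m = mat 1"
    using assms unfolding invertible_def matrix_inv_def by (rule someI_ex)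
  then have "(matrix_inv m ** m) $ i $ j = mat 1 $ i $ j" "(m ** matrix_inv m) $ i $ j = mat 1 $ i $ j"
    by simp_all
  then show "(\<Sum>k\<in>UNIV. matrix_inv m $ i $ k * m $ k $ j) = of_bool (i = j)"
    and "(\<Sum>k\<in>UNIV. m $ i $ k * matrix_inv m $ k $ j) = of_bool (i = j)"
    by (simp_all add: matrix_matrix_mult_def mat_def)
qed

text \<open>\<open>pd\<close> differentiates along a line at parameter 0, so identities known only
  on the open range of a chart determine it; this supplies the required neighbourhood of 0.\<close>

lemma eventually_line_in_open:
  fixes u v :: "'a::real_normed_vector"
  assumes "open S" "u \<in> S"
  shows "eventually (\<lambda>s::real. u + s *\<^sub>R v \<in> S) (nhds 0)"
proof -
  have "isCont (\<lambda>s. u + s *\<^sub>R v) 0"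
    by (intro continuous_intros)
  then have "((\<lambda>s. u + s *\<^sub>R v) \<longlongrightarrow> u) (nhds 0)"
    using tendsto_at_iff_tendsto_nhds[of "\<lambda>s. u + s *\<^sub>R v" 0] by (simp add: isCont_def)
  then show ?thesis
    using assms by (simp add: topological_tendstoD)
qed

lemma pd_cong_open:
  assumes "open S" "u \<in> S" "\<And>w. w \<in> S \<Longrightarrow> f w = g w"
  shows "pd f u v = pd g u v"
  unfolding pd_def
  by (intro deriv_cong_ev eventually_mono[OF eventually_line_in_open[OF assms(1,2), of v]])
    (simp_all add: assms(3))

text \<open>Exchanging the lower indices swaps the first two terms of the formula. The third is
  invariant because the symmetry of the metric, known only on the range of the chart, may be
  differentiated on that open set.\<close>

lemma christoffel_commute:
  assumes g: "riemannian_metric A g" "c \<in> A" and c: "is_chart T c" and u: "u \<in> coord_range c"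
  shows "christoffel (g c) u i j k = christoffel (g c) u i k j"
proof -
  have "open (coord_range c)"
    using c by (simp add: is_chart_def)
  then have "pd (\<lambda>w. g c w $ j $ k) u v = pd (\<lambda>w. g c w $ k $ j) u v" for v
    using u riemannian_metricD(1)[OF g] by (rule pd_cong_open)
  then show ?thesis
    unfolding christoffel_def by (simp add: add.commute)
qed

lemma independent_of_jetsD:
  assumes "independent_of_jets A C X" "a \<in> A" "c \<in> C" "t \<in> coord_range a" "x \<in> coord_range c"
  shows "X a c (t, x, y) = X a c (t, x, y')"
  using assms unfolding independent_of_jets_def by blast

text \<open>A direction with zero jet part keeps \<open>y\<close> and \<open>y'\<close> fixed along
  the two lines, so \<open>X a c\<close> agrees on them while the base point stays in the charts.
  The directions \<open>dt\<close> and \<open>dx\<close> are special cases.\<close>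

lemma pd_independent_of_jets:
  assumes X: "independent_of_jets A C X" "a \<in> A" "c \<in> C"
    and o: "open (coord_range a)" "open (coord_range c)"
    and t: "t \<in> coord_range a" and x: "x \<in> coord_range c"
  shows "pd (\<lambda>w. X a c w $ i $ \<alpha>) (t, x, y) (v, v', 0) = pd (\<lambda>w. X a c w $ i $ \<alpha>) (t, x, y') (v, v', 0)"
proof -
  have "eventually (\<lambda>s. t + s *\<^sub>R v \<in> coord_range a \<and> x + s *\<^sub>R v' \<in> coord_range c) (nhds 0)"
    using o t x by (simp add: eventually_conj_iff eventually_line_in_open)
  then show ?thesis
    unfolding pd_def
    by (intro deriv_cong_ev) (auto elim!: eventually_mono dest: independent_of_jetsD[OF X, of _ _ y y'])
qed

text \<open>Only \<open>X\<close>, its partial derivatives along the base and Christoffel symbols at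
  the base point enter, and all of them are constant on a fibre. Differentiation in \<open>y\<close>
  may thus treat them as coefficients.\<close>

lemma cov_independent_of_jets:
  assumes X: "independent_of_jets A C X" "a \<in> A" "c \<in> C"
    and o: "open (coord_range a)" "open (coord_range c)"
    and t: "t \<in> coord_range a" and x: "x \<in> coord_range c"
  shows "cov_t h (X a c) (t, x, y) i \<alpha> \<beta> = cov_t h (X a c) (t, x, y') i \<alpha> \<beta>"
    and "cov_x \<phi> (X a c) (t, x, y) i \<alpha> j = cov_x \<phi> (X a c) (t, x, y') i \<alpha> j"
  unfolding cov_t_def cov_x_def
  using pd_independent_of_jets[OF assms, where y = y and y' = y'] independent_of_jetsD[OF X t x, of y y']
  by simp_all

text \<open>The sums over \<open>l\<close> and \<open>s\<close> are collected into a single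
  coefficient of \<open>X z $ r $ \<mu> - jet_y z $ r $ \<mu>\<close>, so that the dependence on the
  jet coordinates can be read off.\<close>

lemma spray_trace_canonical_spray:
  fixes h :: "real ^ 'p \<Rightarrow> real ^ 'p ^ ('p::finite)" and \<phi> :: "real ^ 'n \<Rightarrow> real ^ 'n ^ ('n::finite)"
  assumes "invertible (h (jet_t z))" and sym: "\<And>\<alpha> \<beta>. h (jet_t z) $ \<alpha> $ \<beta> = h (jet_t z) $ \<beta> $ \<alpha>"
  shows "spray_trace h (snd (canonical_spray h \<phi> X)) z i =
    1 / 2 * (\<Sum>\<alpha>\<in>UNIV. \<Sum>\<beta>\<in>UNIV. inv_metric h (jet_t z) \<alpha> \<beta> *
      (\<Sum>j\<in>UNIV. \<Sum>k\<in>UNIV. christoffel \<phi> (jet_x z) i j k * jet_y z $ j $ \<alpha> * jet_y z $ k $ \<beta>))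
    - 1 / 2 * (\<Sum>\<mu>\<in>UNIV. \<Sum>\<nu>\<in>UNIV. inv_metric h (jet_t z) \<mu> \<nu> *
      ((\<Sum>r\<in>UNIV. (\<Sum>l\<in>UNIV. \<Sum>s\<in>UNIV. inv_metric \<phi> (jet_x z) i l * cov_x \<phi> X z s \<nu> l *
          \<phi> (jet_x z) $ s $ r) * (X z $ r $ \<mu> - jet_y z $ r $ \<mu>))
       + (\<Sum>m\<in>UNIV. cov_x \<phi> X z i \<nu> m * jet_y z $ m $ \<mu>) + cov_t h X z i \<nu> \<mu>))"
    (is "_ = 1 / 2 * ?Q - 1 / 2 * ?R")
proof -
  have "(\<Sum>\<alpha>\<in>UNIV. \<Sum>\<beta>\<in>UNIV. inv_metric h (jet_t z) \<alpha> \<beta> * h (jet_t z) $ \<alpha> $ \<beta>) =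
      (\<Sum>\<alpha>\<in>(UNIV::'p set). 1)"
  proof (rule sum.cong)
    \<comment> \<open>Symmetry of \<open>h\<close> turns this pairing of rows into a diagonal entry
      of the inverse times \<open>h\<close>.\<close>
    show "(\<Sum>\<beta>\<in>UNIV. inv_metric h (jet_t z) \<alpha> \<beta> * h (jet_t z) $ \<alpha> $ \<beta>) = 1" for \<alpha>
      using sum_matrix_inv(1)[OF assms(1), of \<alpha> \<alpha>] by (simp add: inv_metric_def sym[of \<alpha>])
  qed simp
  then have tr: "(\<Sum>\<alpha>\<in>UNIV. \<Sum>\<beta>\<in>UNIV. inv_metric h (jet_t z) \<alpha> \<beta> * h (jet_t z) $ \<alpha> $ \<beta>) = real CARD('p)"
    by simp
  have swap: "(\<Sum>l\<in>UNIV. \<Sum>s\<in>UNIV. \<Sum>r\<in>UNIV. f l s r * g r) =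
      (\<Sum>r\<in>UNIV. (\<Sum>l\<in>UNIV. \<Sum>s\<in>UNIV. f l s r) * g r)" for f :: "'n \<Rightarrow> 'n \<Rightarrow> 'n \<Rightarrow> real" and g
  proof -
    have "(\<Sum>l\<in>UNIV. \<Sum>s\<in>UNIV. \<Sum>r\<in>UNIV. f l s r * g r) =
        (\<Sum>l\<in>UNIV. \<Sum>r\<in>UNIV. \<Sum>s\<in>UNIV. f l s r * g r)"
      by (intro sum.cong refl sum.swap)
    also have "\<dots> = (\<Sum>r\<in>UNIV. \<Sum>l\<in>UNIV. \<Sum>s\<in>UNIV. f l s r * g r)"
      by (rule sum.swap)
    finally show ?thesis
      by (simp add: sum_distrib_right)
  qed
  have F: "real CARD('p) * edml_F h \<phi> X z i = - (1 / 2) * ?R"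
    by (simp add: edml_F_def swap sum_distrib_left flip: sum_negf)
  have "spray_trace h (snd (canonical_spray h \<phi> X)) z i =
      1 / 2 * ?Q + (\<Sum>\<alpha>\<in>UNIV. \<Sum>\<beta>\<in>UNIV. inv_metric h (jet_t z) \<alpha> \<beta> * h (jet_t z) $ \<alpha> $ \<beta>) * edml_F h \<phi> X z i"
    unfolding spray_trace_def canonical_spray_def snd_conv sum_distrib_left sum_distrib_right
      sum.distrib[symmetric]
    by (intro sum.cong refl) (simp add: algebra_simps sum_distrib_left)
  then show ?thesis
    unfolding tr F by simp
qed

lemma sum_of_bool_mult:
  fixes f :: "'a::finite \<Rightarrow> real"
  shows "(\<Sum>k\<in>UNIV. of_bool (k = j) * f k) = f j"
  by (simp add: of_bool_def if_distrib[where f = "\<lambda>x. x * _"] cong: if_cong)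

text \<open>\<open>Q j \<gamma>\<close> is the trace of \<open>G\<close> along the line in direction \<open>dy j \<gamma>\<close>; the products of \<open>of_bool\<close> terms
  are the components of that direction.\<close>

lemma spatial_contraction:
  fixes h H :: "'p::finite \<Rightarrow> 'p \<Rightarrow> real" and \<Gamma> :: "'n::finite \<Rightarrow> 'n \<Rightarrow> real"
    and y B C V :: "'n \<Rightarrow> 'p \<Rightarrow> real" and D :: "'p \<Rightarrow> 'p \<Rightarrow> real"
  assumes hH: "\<And>\<alpha> \<beta>. (\<Sum>\<gamma>\<in>UNIV. h \<alpha> \<gamma> * H \<gamma> \<beta>) = of_bool (\<alpha> = \<beta>)"
    and Hh: "\<And>\<alpha> \<beta>. (\<Sum>\<gamma>\<in>UNIV. H \<alpha> \<gamma> * h \<gamma> \<beta>) = of_bool (\<alpha> = \<beta>)"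
    and h: "\<And>\<alpha> \<beta>. h \<alpha> \<beta> = h \<beta> \<alpha>" and \<Gamma>: "\<And>k l. \<Gamma> k l = \<Gamma> l k"
  defines "Q \<equiv> \<lambda>j \<gamma> s. 1 / 2 * (\<Sum>\<alpha>\<in>UNIV. \<Sum>\<beta>\<in>UNIV. H \<alpha> \<beta> * (\<Sum>k\<in>UNIV. \<Sum>l\<in>UNIV. \<Gamma> k l *
        (y k \<alpha> + s * (of_bool (k = j) * of_bool (\<alpha> = \<gamma>))) * (y l \<beta> + s * (of_bool (l = j) * of_bool (\<beta> = \<gamma>)))))
      - 1 / 2 * (\<Sum>\<mu>\<in>UNIV. \<Sum>\<nu>\<in>UNIV. H \<mu> \<nu> *
        ((\<Sum>r\<in>UNIV. B r \<nu> * (V r \<mu> - (y r \<mu> + s * (of_bool (r = j) * of_bool (\<mu> = \<gamma>)))))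
         + (\<Sum>m\<in>UNIV. C m \<nu> * (y m \<mu> + s * (of_bool (m = j) * of_bool (\<mu> = \<gamma>)))) + D \<nu> \<mu>))"
  shows "(\<Sum>\<gamma>\<in>UNIV. deriv (Q j \<gamma>) 0 * h \<alpha> \<gamma>) = (\<Sum>k\<in>UNIV. \<Gamma> j k * y k \<alpha>) - 1 / 2 * (C j \<alpha> - B j \<alpha>)"
proof -
  \<comment> \<open>Lowering with \<open>h\<close> undoes raising with \<open>H\<close>. Two
    versions serve the two positions of the free index, as the product rule hits either factor of
    the quadratic part and symmetry of \<open>H\<close> is not among the assumptions.\<close>
  have contract: "(\<Sum>\<gamma>\<in>UNIV. (\<Sum>\<beta>\<in>UNIV. H \<gamma> \<beta> * f \<beta>) * h \<alpha> \<gamma>) = f \<alpha>" for f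
  proof -
    have "(\<Sum>\<gamma>\<in>UNIV. (\<Sum>\<beta>\<in>UNIV. H \<gamma> \<beta> * f \<beta>) * h \<alpha> \<gamma>) = (\<Sum>\<beta>\<in>UNIV. (\<Sum>\<gamma>\<in>UNIV. h \<alpha> \<gamma> * H \<gamma> \<beta>) * f \<beta>)"
      unfolding sum_distrib_right by (subst sum.swap) (simp add: mult_ac)
    also have "\<dots> = f \<alpha>"
      by (simp add: hH eq_commute[of \<alpha>] sum_of_bool_mult)
    finally show ?thesis .
  qed
  have contract': "(\<Sum>\<gamma>\<in>UNIV. (\<Sum>\<beta>\<in>UNIV. H \<beta> \<gamma> * f \<beta>) * h \<alpha> \<gamma>) = f \<alpha>" for f
  proof -
    have "(\<Sum>\<gamma>\<in>UNIV. (\<Sum>\<beta>\<in>UNIV. H \<beta> \<gamma> * f \<beta>) * h \<alpha> \<gamma>) = (\<Sum>\<beta>\<in>UNIV. (\<Sum>\<gamma>\<in>UNIV. H \<beta> \<gamma> * h \<gamma> \<alpha>) * f \<beta>)"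
      unfolding sum_distrib_right by (subst sum.swap) (simp add: mult_ac h[of \<alpha>])
    also have "\<dots> = f \<alpha>"
      by (simp add: Hh sum_of_bool_mult)
    finally show ?thesis .
  qed
  let ?e = "\<lambda>\<gamma> k \<alpha>. of_bool (k = j) * of_bool (\<alpha> = \<gamma>) :: real"
  \<comment> \<open>The first two terms come from the two factors of the quadratic part, made alike
    by the symmetry of \<open>\<Gamma>\<close>. The minus sign at \<open>B\<close> stems from
    \<open>V - y\<close>; \<open>V\<close> and \<open>D\<close> are constant in
    \<open>s\<close>.\<close>
  have deriv: "deriv (Q j \<gamma>) 0 =
      1 / 2 * (\<Sum>\<beta>\<in>UNIV. H \<gamma> \<beta> * (\<Sum>l\<in>UNIV. \<Gamma> j l * y l \<beta>))
      + 1 / 2 * (\<Sum>\<beta>\<in>UNIV. H \<beta> \<gamma> * (\<Sum>l\<in>UNIV. \<Gamma> j l * y l \<beta>))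
      - 1 / 2 * (\<Sum>\<nu>\<in>UNIV. H \<gamma> \<nu> * (C j \<nu> - B j \<nu>))" for \<gamma>
  proof -
    have "(Q j \<gamma> has_real_derivative
        1 / 2 * (\<Sum>\<alpha>\<in>UNIV. \<Sum>\<beta>\<in>UNIV. H \<alpha> \<beta> * (\<Sum>k\<in>UNIV. \<Sum>l\<in>UNIV. \<Gamma> k l * (?e \<gamma> k \<alpha> * y l \<beta> + y k \<alpha> * ?e \<gamma> l \<beta>)))
        - 1 / 2 * (\<Sum>\<mu>\<in>UNIV. \<Sum>\<nu>\<in>UNIV. H \<mu> \<nu> *
          ((\<Sum>r\<in>UNIV. B r \<nu> * (- ?e \<gamma> r \<mu>)) + (\<Sum>m\<in>UNIV. C m \<nu> * ?e \<gamma> m \<mu>)))) (at 0)"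
      unfolding Q_def
      by (rule DERIV_diff DERIV_cmult DERIV_sum
          | (auto intro!: derivative_eq_intros sum.cong simp: algebra_simps; fail))+
    \<comment> \<open>Each Kronecker factor is moved directly under the sum over its index, where
      \<open>sum_of_bool_mult\<close> collapses it.\<close>
    moreover have "(\<Sum>\<alpha>\<in>UNIV. \<Sum>\<beta>\<in>UNIV. H \<alpha> \<beta> * (\<Sum>k\<in>UNIV. \<Sum>l\<in>UNIV. \<Gamma> k l * (?e \<gamma> k \<alpha> * y l \<beta> + y k \<alpha> * ?e \<gamma> l \<beta>))) =
      (\<Sum>\<alpha>\<in>UNIV. of_bool (\<alpha> = \<gamma>) * (\<Sum>\<beta>\<in>UNIV. H \<alpha> \<beta> * (\<Sum>k\<in>UNIV. of_bool (k = j) * (\<Sum>l\<in>UNIV. \<Gamma> k l * y l \<beta>))))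
      + (\<Sum>\<alpha>\<in>UNIV. \<Sum>\<beta>\<in>UNIV. of_bool (\<beta> = \<gamma>) * (H \<alpha> \<beta> * (\<Sum>k\<in>UNIV. \<Sum>l\<in>UNIV. of_bool (l = j) * (\<Gamma> k l * y k \<alpha>))))"
      by (simp add: sum_distrib_left algebra_simps flip: sum.distrib)
    moreover have "(\<Sum>\<mu>\<in>UNIV. \<Sum>\<nu>\<in>UNIV. H \<mu> \<nu> *
          ((\<Sum>r\<in>UNIV. B r \<nu> * (- ?e \<gamma> r \<mu>)) + (\<Sum>m\<in>UNIV. C m \<nu> * ?e \<gamma> m \<mu>))) =
      (\<Sum>\<mu>\<in>UNIV. of_bool (\<mu> = \<gamma>) * (\<Sum>\<nu>\<in>UNIV. H \<mu> \<nu> * (\<Sum>m\<in>UNIV. of_bool (m = j) * (C m \<nu> - B m \<nu>))))"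
      by (simp add: sum_distrib_left algebra_simps flip: sum.distrib)
    ultimately show ?thesis
      unfolding sum_of_bool_mult by (simp add: DERIV_imp_deriv \<Gamma>[of _ j] distrib_left)
  qed
  have "(\<Sum>\<gamma>\<in>UNIV. deriv (Q j \<gamma>) 0 * h \<alpha> \<gamma>) =
      1 / 2 * (\<Sum>\<gamma>\<in>UNIV. (\<Sum>\<beta>\<in>UNIV. H \<gamma> \<beta> * (\<Sum>l\<in>UNIV. \<Gamma> j l * y l \<beta>)) * h \<alpha> \<gamma>)
      + 1 / 2 * (\<Sum>\<gamma>\<in>UNIV. (\<Sum>\<beta>\<in>UNIV. H \<beta> \<gamma> * (\<Sum>l\<in>UNIV. \<Gamma> j l * y l \<beta>)) * h \<alpha> \<gamma>)
      - 1 / 2 * (\<Sum>\<gamma>\<in>UNIV. (\<Sum>\<nu>\<in>UNIV. H \<gamma> \<nu> * (C j \<nu> - B j \<nu>)) * h \<alpha> \<gamma>)"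
    unfolding deriv
    by (simp only: left_diff_distrib distrib_right sum.distrib sum_subtractf sum_distrib_left[symmetric] mult.assoc)
  then show ?thesis
    unfolding contract contract' by simp
qed

theorem theorem2p1:
  fixes TT :: "'t topology" and AT :: "('t, 'p::finite) chart set"
    and MM :: "'m topology" and AM :: "('m, 'n::finite) chart set"
    and h :: "('t, 'p) chart \<Rightarrow> real ^ 'p \<Rightarrow> real ^ 'p ^ 'p"
    and \<phi> :: "('m, 'n) chart \<Rightarrow> real ^ 'n \<Rightarrow> real ^ 'n ^ 'n"
    and X :: "('t, 'p) chart \<Rightarrow> ('m, 'n) chart \<Rightarrow> ('p, 'n) jet \<Rightarrow> real ^ 'p ^ 'n"
    and H G :: "('p, 'n) temporal"
    and M :: "('p, 'n) temporal" and N :: "('p, 'n) spatial"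
  assumes "connected_smooth_manifold TT AT" and "riemannian_metric AT h"
    and "connected_smooth_manifold MM AM" and "riemannian_metric AM \<phi>"
    and "d_tensor AT AM X" and "independent_of_jets AT AM X"
    and "a \<in> AT" and "c \<in> AM"
    and "(H, G) = canonical_spray (h a) (\<phi> c) (X a c)"
    and "(M, N) = canonical_connection (h a) (\<phi> c) (X a c)"
  shows "\<forall>z\<in>jet_domain a c.
      (\<forall>i \<alpha> \<beta>. M z i \<alpha> \<beta> = 2 * H z i \<alpha> \<beta> \<and> 2 * H z i \<alpha> \<beta> = M0 (h a) z i \<alpha> \<beta>) \<and>
      (\<forall>i \<alpha> j.
         N z i \<alpha> j = (\<Sum>\<gamma>\<in>UNIV. pd (\<lambda>w. spray_trace (h a) G w i) z (dy j \<gamma>) * h a (jet_t z) $ \<alpha> $ \<gamma>) \<and>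
         (\<Sum>\<gamma>\<in>UNIV. pd (\<lambda>w. spray_trace (h a) G w i) z (dy j \<gamma>) * h a (jet_t z) $ \<alpha> $ \<gamma>)
           = N0 (\<phi> c) z i \<alpha> j - edml_force (\<phi> c) (X a c) z i \<alpha> j)"
proof -
  have HG: "H = fst (canonical_spray (h a) (\<phi> c) (X a c))" "G = snd (canonical_spray (h a) (\<phi> c) (X a c))"
    using assms(9) by (metis fst_conv, metis snd_conv)
  have MN: "M = (\<lambda>z i \<alpha> \<beta>. 2 * H z i \<alpha> \<beta>)"
    "N = (\<lambda>z i \<alpha> j. \<Sum>\<gamma>\<in>UNIV. pd (\<lambda>w. spray_trace (h a) G w i) z (dy j \<gamma>) * h a (jet_t z) $ \<alpha> $ \<gamma>)"
    using assms(10) unfolding canonical_connection_def connection_of_spray_def HG by auto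
  have charts: "is_chart TT a" "is_chart MM c"
    using assms(1,3,7,8) by (auto simp: connected_smooth_manifold_def)
  then have op: "open (coord_range a)" "open (coord_range c)"
    by (auto simp: is_chart_def)
  have spatial: "(\<Sum>\<gamma>\<in>UNIV. pd (\<lambda>w. spray_trace (h a) G w i) (t, x, y) (dy j \<gamma>) * h a t $ \<alpha> $ \<gamma>)
      = N0 (\<phi> c) (t, x, y) i \<alpha> j - edml_force (\<phi> c) (X a c) (t, x, y) i \<alpha> j"
    if t: "t \<in> coord_range a" and x: "x \<in> coord_range c" for t x y i \<alpha> j
  proof -
    note h_sym = riemannian_metricD(1)[OF assms(2,7) t]
    note h_inv = riemannian_metricD(2)[OF assms(2,7) t]
    note indep = assms(6,7,8)
    \<comment> \<open>Freezes the coefficients at \<open>y\<close> for every \<open>w\<close> in the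
      fibre, so that \<open>trace\<close> below depends on \<open>w\<close> only through its
      explicit components.\<close>
    have X: "X a c (t, x, w) = X a c (t, x, y)"
      "cov_t (h a) (X a c) (t, x, w) = cov_t (h a) (X a c) (t, x, y)"
      "cov_x (\<phi> c) (X a c) (t, x, w) = cov_x (\<phi> c) (X a c) (t, x, y)" for w
      using independent_of_jetsD[OF indep t x] cov_independent_of_jets[OF indep op t x]
      by (blast intro!: ext)+
    have axis: "axis j (axis \<gamma> (1::real)) $ k $ \<beta> = of_bool (k = j) * of_bool (\<beta> = \<gamma>)" for \<gamma> k \<beta>
      by (simp add: axis_def)
    have line: "(t, x, y) + s *\<^sub>R dy j \<gamma> = (t, x, y + s *\<^sub>R axis j (axis \<gamma> 1))" for s \<gamma>
      by simp
    have inv: "(\<Sum>\<gamma>\<in>UNIV. h a t $ \<alpha> $ \<gamma> * inv_metric (h a) t \<gamma> \<beta>) = of_bool (\<alpha> = \<beta>)"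
      "(\<Sum>\<gamma>\<in>UNIV. inv_metric (h a) t \<alpha> \<gamma> * h a t $ \<gamma> $ \<beta>) = of_bool (\<alpha> = \<beta>)" for \<alpha> \<beta>
      using sum_matrix_inv[OF h_inv] by (simp_all add: inv_metric_def)
    have trace: "spray_trace (h a) G (t, x, w) i =
      1 / 2 * (\<Sum>\<alpha>\<in>UNIV. \<Sum>\<beta>\<in>UNIV. inv_metric (h a) t \<alpha> \<beta> *
        (\<Sum>j\<in>UNIV. \<Sum>k\<in>UNIV. christoffel (\<phi> c) x i j k * w $ j $ \<alpha> * w $ k $ \<beta>))
      - 1 / 2 * (\<Sum>\<mu>\<in>UNIV. \<Sum>\<nu>\<in>UNIV. inv_metric (h a) t \<mu> \<nu> *
        ((\<Sum>r\<in>UNIV. (\<Sum>l\<in>UNIV. \<Sum>s\<in>UNIV. inv_metric (\<phi> c) x i l * cov_x (\<phi> c) (X a c) (t, x, y) s \<nu> l *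
            \<phi> c x $ s $ r) * (X a c (t, x, y) $ r $ \<mu> - w $ r $ \<mu>))
         + (\<Sum>m\<in>UNIV. cov_x (\<phi> c) (X a c) (t, x, y) i \<nu> m * w $ m $ \<mu>)
         + cov_t (h a) (X a c) (t, x, y) i \<nu> \<mu>))" for w
      using spray_trace_canonical_spray[of "h a" "(t, x, w)" "\<phi> c" "X a c" i] h_inv h_sym
      unfolding HG fst_conv snd_conv X[of w] by blast
    \<comment> \<open>Along the line the trace now has the form of \<open>Q\<close>, with the
      inverse of \<open>h\<close> as \<open>H\<close>, the Christoffel symbols of
      \<open>\<phi>\<close> with upper index \<open>i\<close> as \<open>\<Gamma>\<close>, and
      \<open>cov_x\<close> with upper index \<open>i\<close> as \<open>C\<close>. Since
      \<open>B\<close> is the contraction of \<open>cov_x\<close> with \<open>\<phi>\<close> and its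
      inverse, half of \<open>C - B\<close> is the force.\<close>
    show ?thesis
      unfolding pd_def line trace vector_add_component vector_scaleR_component real_scaleR_def axis
      by (subst spatial_contraction[where h = "\<lambda>\<alpha> \<beta>. h a t $ \<alpha> $ \<beta>", OF inv h_sym
            christoffel_commute[OF assms(4,8) charts(2) x]])
        (simp add: N0_def edml_force_def)
  qed
  show ?thesis
    using spatial
    by (auto simp: MN M0_def HG(1) canonical_spray_def jet_domain_def)
qed

end
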